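(* Let $s\in\mathbb{R}\setminus\{0\}$, let $\rho_0\in(0,1)$, $\phi_0\in\mathbb{R}$, and let $\Xi_0=\rho_0e^{i\phi_0}\in B_1(0)\setminus\{0\}$, where $B_1(0)$ is the open unit disk of $\mathbb{R}^2\cong\mathbb{C}$. Set $\mu_0=(1-\rho_0^2)/\rho_0^2>0$. Then the solution of the Cauchy problem $$\dot\Xi(T)=2s^2(1-|\Xi(T)|^2)\,\Xi(T)\quad (T>0),\qquad \Xi(0)=\Xi_0,$$ is $\Xi(T)=\rho(T)e^{i\phi(T)}$ with $$\rho(T)=\frac{1}{\sqrt{1+\mu_0\exp(-4s^2T)}},\qquad \phi(T)=\phi_0,\qquad\text{for all }T\in[0,+\infty).$$ In particular the motion is purely radial, and $\rho(T)\to1$ as $T\to+\infty$; that is, the disclination reaches the boundary of $B_1(0)$ only in the limit $T\to+\infty$.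
   Context: This is the non-dimensional dynamics of a single wedge disclination with Frank angle $s$ and position $\Xi(T)\in B_1(0)$, moving by the negative gradient of the elastic energy $\frac12 s^2(1-|\Xi|^2)^2$. Points of $\mathbb{R}^2$ are identified with complex numbers. A dot denotes $\mathrm{d}/\mathrm{d}T$. *)

theory Defs
  imports "HOL-Analysis.Analysis"
begin

text \<open>
  The position lives in \<open>\<complex>\<close>, identified with the plane. The equation is imposed only at positive
  times, so the initial value is tied to the motion by continuity on \<open>{0..}\<close>. That the motion stays
  in the unit disk is not required of a solution.
\<close>

definition cauchy_solution :: "real \<Rightarrow> complex \<Rightarrow> (real \<Rightarrow> complex) \<Rightarrow> bool" where
  "cauchy_solution s \<Xi>\<^sub>0 \<Xi> \<longleftrightarrow>
     continuous_on {0..} \<Xi> \<and>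
     (\<forall>T>0. (\<Xi> has_vector_derivative (2 * s\<^sup>2 * (1 - (norm (\<Xi> T))\<^sup>2)) *\<^sub>R \<Xi> T) (at T)) \<and>
     \<Xi> 0 = \<Xi>\<^sub>0"

end

theory Submission
  imports Defs
begin

text \<open>
  The vector field \<open>z \<mapsto> c (1 - \<bar>z\<bar>\<^sup>2) z\<close> is one-sided Lipschitz on the whole plane, because
  \<open>z \<mapsto> \<bar>z\<bar>\<^sup>2 z\<close> is a monotone operator (the gradient of the convex function \<open>\<bar>z\<bar>\<^sup>4 / 4\<close>). By Gronwall
  applied to the squared distance of two solutions, solutions are unique forward in time, without
  any a priori bound on them. It remains to check that the explicit radial motion is a solution.
\<close>

lemma one_sided_Lipschitz_imp_unique:
  fixes X Y :: "real \<Rightarrow> 'a::real_inner"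
  assumes lip: "\<And>x y. (f x - f y) \<bullet> (x - y) \<le> c * (norm (x - y))\<^sup>2"
    and contX: "continuous_on {0..} X" and contY: "continuous_on {0..} Y"
    and derX: "\<And>t. t > 0 \<Longrightarrow> (X has_vector_derivative f (X t)) (at t)"
    and derY: "\<And>t. t > 0 \<Longrightarrow> (Y has_vector_derivative f (Y t)) (at t)"
    and init: "X 0 = Y 0" and "T \<ge> 0"
  shows "X T = Y T"
proof (cases "T = 0")
  case False
  with \<open>T \<ge> 0\<close> have "T > 0" by simp
  \<comment> \<open>The one-sided bound gives D' \<le> 2 c D for the squared distance D; the
    integrating factor turns this into g' \<le> 0.\<close>
  define g where "g t = ((X t - Y t) \<bullet> (X t - Y t)) * exp (- 2 * c * t)" for t
  have "continuous_on {0..T} X" "continuous_on {0..T} Y"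
    using contX contY by (auto elim: continuous_on_subset)
  then have cont: "continuous_on {0..T} g"
    unfolding g_def by (intro continuous_intros)
  have "g T \<le> g 0"
  \<comment> \<open>The equations hold only at positive times, so the derivative is controlled on
    the open interval and continuity brings in time 0.\<close>
  proof (rule DERIV_nonpos_imp_decreasing_open[OF \<open>T \<ge> 0\<close> _ cont])
    fix t :: real assume t: "0 < t" "t < T"
    let ?w = "X t - Y t"
    let ?w' = "f (X t) - f (Y t)"
    have "((\<lambda>t. X t - Y t) has_derivative (\<lambda>h. h *\<^sub>R ?w')) (at t)"
      using has_vector_derivative_diff[OF derX derY] t
      by (simp add: has_vector_derivative_def)
    from has_derivative_inner[OF this this]
    have "((\<lambda>t. (X t - Y t) \<bullet> (X t - Y t)) has_real_derivative 2 * (?w' \<bullet> ?w)) (at t)"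
      unfolding has_field_derivative_def
      by (rule has_derivative_eq_rhs) (simp add: fun_eq_iff inner_commute)
    moreover have "((\<lambda>t. exp (- 2 * c * t)) has_real_derivative exp (- 2 * c * t) * (- 2 * c)) (at t)"
      by (auto intro!: derivative_eq_intros)
    ultimately have "(g has_real_derivative
        2 * (?w' \<bullet> ?w) * exp (- 2 * c * t) + exp (- 2 * c * t) * (- 2 * c) * (?w \<bullet> ?w)) (at t)"
      unfolding g_def by (rule DERIV_mult)
    moreover have "2 * (?w' \<bullet> ?w) * exp (- 2 * c * t) + exp (- 2 * c * t) * (- 2 * c) * (?w \<bullet> ?w)
        = 2 * exp (- 2 * c * t) * (?w' \<bullet> ?w - c * (norm ?w)\<^sup>2)"
      by (simp add: power2_norm_eq_inner algebra_simps)
    moreover have "\<dots> \<le> 0"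
      using lip[of "X t" "Y t"] by (intro mult_nonneg_nonpos) auto
    ultimately show "\<exists>y. (g has_real_derivative y) (at t) \<and> y \<le> 0"
      by metis
  qed
  then have "(X T - Y T) \<bullet> (X T - Y T) \<le> 0"
    using init by (simp add: g_def mult_le_0_iff not_le)
  then have "(X T - Y T) \<bullet> (X T - Y T) = 0"
    by (rule antisym) (rule inner_ge_zero)
  then show ?thesis by simp
qed (use init in simp)

text \<open>With a and b the squared norms of x and y, the product expands to a^2 + b^2 - (a + b) (x
  \<bullet> y). Since x \<bullet> y \<le> (a + b) / 2, it is at least (a - b)^2 / 2.\<close>

lemma norm_square_scaleR_monotone:
  fixes x y :: "'a::real_inner"
  shows "0 \<le> ((norm x)\<^sup>2 *\<^sub>R x - (norm y)\<^sup>2 *\<^sub>R y) \<bullet> (x - y)"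
proof -
  let ?a = "x \<bullet> x" and ?b = "y \<bullet> y"
  have "0 \<le> (x - y) \<bullet> (x - y)" by simp
  then have "2 * (x \<bullet> y) \<le> ?a + ?b"
    by (simp add: inner_diff inner_commute)
  then have "(?a + ?b) * (2 * (x \<bullet> y)) \<le> (?a + ?b) * (?a + ?b)"
    by (intro mult_left_mono) auto
  moreover have "0 \<le> (?a - ?b)\<^sup>2" by simp
  ultimately have "(?a + ?b) * (x \<bullet> y) \<le> ?a\<^sup>2 + ?b\<^sup>2"
    by (simp add: power2_eq_square algebra_simps)
  then show ?thesis
    unfolding power2_norm_eq_inner
    by (simp add: inner_diff inner_commute power2_eq_square algebra_simps)
qed

text \<open>The field is 2 s^2 (z - |z|^2 z). Its linear part contributes exactly 2 s^2 |x - y|^2 to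
  the one-sided estimate and its cubic part a nonpositive amount, so
  \<open>c = 2 * s\<^sup>2\<close> works on the whole plane, also for competitors that might leave
  the disk.\<close>

lemma cauchy_solution_unique:
  assumes "cauchy_solution s z X" "cauchy_solution s z Y" "T \<ge> 0"
  shows "X T = Y T"
proof (rule one_sided_Lipschitz_imp_unique
    [where f = "\<lambda>z. (2 * s\<^sup>2 * (1 - (norm z)\<^sup>2)) *\<^sub>R z" and c = "2 * s\<^sup>2"])
  fix x y :: complex
  have "(2 * s\<^sup>2 * (1 - (norm x)\<^sup>2)) *\<^sub>R x - (2 * s\<^sup>2 * (1 - (norm y)\<^sup>2)) *\<^sub>R y
      = (2 * s\<^sup>2) *\<^sub>R ((x - y) - ((norm x)\<^sup>2 *\<^sub>R x - (norm y)\<^sup>2 *\<^sub>R y))"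
    by (simp add: algebra_simps)
  then have "((2 * s\<^sup>2 * (1 - (norm x)\<^sup>2)) *\<^sub>R x - (2 * s\<^sup>2 * (1 - (norm y)\<^sup>2)) *\<^sub>R y) \<bullet> (x - y)
      = 2 * s\<^sup>2 * ((norm (x - y))\<^sup>2 - ((norm x)\<^sup>2 *\<^sub>R x - (norm y)\<^sup>2 *\<^sub>R y) \<bullet> (x - y))"
    by (simp only: inner_scaleR_left inner_diff_left[of "x - y"] power2_norm_eq_inner)
  also have "\<dots> \<le> 2 * s\<^sup>2 * (norm (x - y))\<^sup>2"
    using norm_square_scaleR_monotone[of x y] by (intro mult_left_mono) auto
  finally show "((2 * s\<^sup>2 * (1 - (norm x)\<^sup>2)) *\<^sub>R x - (2 * s\<^sup>2 * (1 - (norm y)\<^sup>2)) *\<^sub>R y) \<bullet> (x - y)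
      \<le> 2 * s\<^sup>2 * (norm (x - y))\<^sup>2" .
qed (use assms in \<open>auto simp: cauchy_solution_def\<close>)

text \<open>The square of the radius is the logistic function, which solves P' = 4 s^2 P (1 - P). In
  terms of E and q below, both sides of the radial equation equal 2 s^2 E / q^3; positivity of
  \<open>\<mu>\<close> keeps the root away from 0.\<close>

lemma logistic_radius_has_derivative:
  fixes s \<mu> t :: real
  assumes "\<mu> > 0"
  defines "\<rho> \<equiv> \<lambda>T. 1 / sqrt (1 + \<mu> * exp (- 4 * s\<^sup>2 * T))"
  shows "(\<rho> has_real_derivative 2 * s\<^sup>2 * (1 - (\<rho> t)\<^sup>2) * \<rho> t) (at t)"
proof -
  define E where "E = \<mu> * exp (- 4 * s\<^sup>2 * t)"
  define q where "q = sqrt (1 + E)"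
  have "E > 0" using assms by (simp add: E_def)
  then have q: "q > 0" "q\<^sup>2 = 1 + E" by (auto simp: q_def)
  have "((\<lambda>T. 1 + \<mu> * exp (- 4 * s\<^sup>2 * T)) has_real_derivative - 4 * s\<^sup>2 * E) (at t)"
    unfolding E_def by (rule derivative_eq_intros refl | simp)+
  moreover have "(sqrt has_real_derivative inverse q / 2) (at (1 + \<mu> * exp (- 4 * s\<^sup>2 * t)))"
    using DERIV_real_sqrt[of "1 + E"] \<open>E > 0\<close> by (simp add: q_def E_def)
  ultimately have "((\<lambda>T. sqrt (1 + \<mu> * exp (- 4 * s\<^sup>2 * T))) has_real_derivative
      inverse q / 2 * (- 4 * s\<^sup>2 * E)) (at t)"
    by (rule DERIV_chain2[rotated])
  from DERIV_inverse'[OF this]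
  have "((\<lambda>T. inverse (sqrt (1 + \<mu> * exp (- 4 * s\<^sup>2 * T)))) has_real_derivative
      - (inverse q * (inverse q / 2 * (- 4 * s\<^sup>2 * E)) * inverse q)) (at t)"
    unfolding E_def[symmetric] q_def[symmetric] using q(1) by blast
  moreover have "- (inverse q * (inverse q / 2 * (- 4 * s\<^sup>2 * E)) * inverse q) = 2 * s\<^sup>2 * E / q ^ 3"
    by (simp add: power3_eq_cube inverse_eq_divide)
  moreover have "\<rho> = (\<lambda>T. inverse (sqrt (1 + \<mu> * exp (- 4 * s\<^sup>2 * T))))"
    by (simp add: \<rho>_def inverse_eq_divide)
  ultimately have "(\<rho> has_real_derivative 2 * s\<^sup>2 * E / q ^ 3) (at t)"
    by simp
  \<comment> \<open>Here 1 / q is the radius at time t, and q^2 - 1 = E.\<close>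
  moreover have "1 - (1 / q)\<^sup>2 = E / q\<^sup>2"
    using q \<open>E > 0\<close> by (simp add: power_divide field_simps)
  then have "2 * s\<^sup>2 * (1 - (1 / q)\<^sup>2) * (1 / q) = 2 * s\<^sup>2 * E / q ^ 3"
    by (simp add: power3_eq_cube power2_eq_square)
  then have "2 * s\<^sup>2 * (1 - (\<rho> t)\<^sup>2) * \<rho> t = 2 * s\<^sup>2 * E / q ^ 3"
    by (simp add: \<rho>_def q_def E_def)
  ultimately show ?thesis by simp
qed

text \<open>A nonzero s makes the rate -4 s^2 strictly negative, so the exponential dies
  out.\<close>

lemma logistic_radius_tendsto_1:
  fixes s \<mu> :: real
  assumes "s \<noteq> 0"
  shows "((\<lambda>T. 1 / sqrt (1 + \<mu> * exp (- 4 * s\<^sup>2 * T))) \<longlongrightarrow> 1) at_top"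
proof -
  have "LIM T at_top. (- 4 * s\<^sup>2) * T :> at_bot"
    using assms by (intro filterlim_tendsto_neg_mult_at_bot[OF tendsto_const _ filterlim_ident]) simp
  then have "((\<lambda>T. exp (- 4 * s\<^sup>2 * T)) \<longlongrightarrow> 0) at_top"
    by (rule filterlim_compose[OF exp_at_bot])
  then have "((\<lambda>T. 1 / sqrt (1 + \<mu> * exp (- 4 * s\<^sup>2 * T))) \<longlongrightarrow> 1 / sqrt (1 + \<mu> * 0)) at_top"
    by (intro tendsto_intros) auto
  then show ?thesis by simp
qed

theorem mainTheorem2:
  fixes s \<rho>\<^sub>0 \<phi>\<^sub>0 \<mu>\<^sub>0 :: real and \<Xi>\<^sub>0 :: complex and \<rho> \<phi> :: "real \<Rightarrow> real"
  assumes "s \<noteq> 0"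
    and "\<rho>\<^sub>0 \<in> {0<..<1}"
    and "\<Xi>\<^sub>0 = of_real \<rho>\<^sub>0 * exp (\<i> * of_real \<phi>\<^sub>0)"
    and "\<mu>\<^sub>0 = (1 - \<rho>\<^sub>0\<^sup>2) / \<rho>\<^sub>0\<^sup>2"
    and "\<rho> = (\<lambda>T. 1 / sqrt (1 + \<mu>\<^sub>0 * exp (- 4 * s\<^sup>2 * T)))"
    and "\<phi> = (\<lambda>T. \<phi>\<^sub>0)"
  shows "\<Xi>\<^sub>0 \<in> ball 0 1 - {0} \<and> \<mu>\<^sub>0 > 0 \<and>
    cauchy_solution s \<Xi>\<^sub>0 (\<lambda>T. of_real (\<rho> T) * exp (\<i> * of_real (\<phi> T))) \<and>
    (\<rho> \<longlongrightarrow> 1) at_top \<and>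
    (\<forall>\<Xi>. cauchy_solution s \<Xi>\<^sub>0 \<Xi> \<longrightarrow>
       (\<forall>T\<ge>0. \<Xi> T = of_real (\<rho> T) * exp (\<i> * of_real (\<phi> T))) \<and>
       (\<forall>T\<ge>0. sgn (\<Xi> T) = sgn \<Xi>\<^sub>0) \<and>
       (\<forall>T\<ge>0. \<Xi> T \<in> ball 0 1) \<and>
       (\<exists>\<xi> \<in> frontier (ball 0 1). (\<Xi> \<longlongrightarrow> \<xi>) at_top))"
proof -
  define u where "u = exp (\<i> * of_real \<phi>\<^sub>0)"
  have norm_u: "norm u = 1" by (simp add: u_def)
  have \<rho>\<^sub>0: "0 < \<rho>\<^sub>0" "\<rho>\<^sub>0 < 1" using assms(2) by auto
  have \<mu>: "\<mu>\<^sub>0 > 0" using \<rho>\<^sub>0 by (simp add: assms(4) power_less_one_iff)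
  have \<Xi>\<^sub>0: "\<Xi>\<^sub>0 = of_real \<rho>\<^sub>0 * u" by (simp add: assms(3) u_def)
  have radial: "(\<lambda>T. of_real (\<rho> T) * exp (\<i> * of_real (\<phi> T))) = (\<lambda>T. of_real (\<rho> T) * u)"
    by (simp add: assms(6) u_def)
  \<comment> \<open>This identity is what the choice of \<open>\<mu>\<^sub>0\<close> is for: it
    makes the explicit radius start at \<open>\<rho>\<^sub>0\<close>.\<close>
  have "1 + \<mu>\<^sub>0 = (1 / \<rho>\<^sub>0)\<^sup>2" using \<rho>\<^sub>0 by (simp add: assms(4) field_simps)
  then have \<rho>_init: "\<rho> 0 = \<rho>\<^sub>0" using \<rho>\<^sub>0 by (simp add: assms(5))
  have \<rho>_bounds: "0 < \<rho> T" "\<rho> T < 1" for T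
  proof -
    have "0 < \<mu>\<^sub>0 * exp (- 4 * s\<^sup>2 * T)" using \<mu> by simp
    then show "0 < \<rho> T" "\<rho> T < 1" unfolding assms(5) by auto
  qed
  have \<rho>_deriv: "(\<rho> has_real_derivative 2 * s\<^sup>2 * (1 - (\<rho> t)\<^sup>2) * \<rho> t) (at t)" for t
    unfolding assms(5) by (rule logistic_radius_has_derivative[OF \<mu>])
  have \<rho>_lim: "(\<rho> \<longlongrightarrow> 1) at_top"
    unfolding assms(5) by (rule logistic_radius_tendsto_1[OF assms(1)])
  \<comment> \<open>Along the fixed unit direction u the modulus is the radius itself, so the planar
    equation reduces to the scalar one. It holds at every real t, hence continuity on
    \<open>{0..}\<close> follows from differentiability.\<close>
  have deriv: "((\<lambda>T. of_real (\<rho> T) * u) has_vector_derivative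
      (2 * s\<^sup>2 * (1 - (norm (of_real (\<rho> t) * u))\<^sup>2)) *\<^sub>R (of_real (\<rho> t) * u)) (at t)" for t
  proof -
    have "((\<lambda>T. \<rho> T *\<^sub>R u) has_vector_derivative (2 * s\<^sup>2 * (1 - (\<rho> t)\<^sup>2) * \<rho> t) *\<^sub>R u) (at t)"
      using has_vector_derivative_scaleR[OF \<rho>_deriv has_vector_derivative_const[of u]] by simp
    then show ?thesis
      by (simp add: scaleR_conv_of_real norm_mult norm_u mult.assoc)
  qed
  have "continuous_on {0..} (\<lambda>T. of_real (\<rho> T) * u)"
    using deriv by (intro continuous_at_imp_continuous_on ballI has_vector_derivative_continuous)
  then have sol: "cauchy_solution s \<Xi>\<^sub>0 (\<lambda>T. of_real (\<rho> T) * u)"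
    using deriv by (simp add: cauchy_solution_def \<rho>_init \<Xi>\<^sub>0)
  have "(\<forall>T\<ge>0. \<Xi> T = of_real (\<rho> T) * u) \<and> (\<forall>T\<ge>0. sgn (\<Xi> T) = sgn \<Xi>\<^sub>0) \<and>
      (\<forall>T\<ge>0. \<Xi> T \<in> ball 0 1) \<and> (\<exists>\<xi> \<in> frontier (ball 0 1). (\<Xi> \<longlongrightarrow> \<xi>) at_top)"
    if "cauchy_solution s \<Xi>\<^sub>0 \<Xi>" for \<Xi>
  proof -
    have eq: "\<Xi> T = of_real (\<rho> T) * u" if "T \<ge> 0" for T
      using cauchy_solution_unique[OF \<open>cauchy_solution s \<Xi>\<^sub>0 \<Xi>\<close> sol that] .
    \<comment> \<open>Radial motion: both points are positive multiples of u, so they share the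
      direction z / |z|.\<close>
    have "sgn (\<Xi> T) = sgn \<Xi>\<^sub>0" if "T \<ge> 0" for T
      using \<rho>\<^sub>0 \<rho>_bounds[of T] by (simp add: eq[OF that] \<Xi>\<^sub>0 sgn_mult sgn_of_real)
    moreover have "\<Xi> T \<in> ball 0 1" if "T \<ge> 0" for T
      using \<rho>_bounds[of T] by (simp add: eq[OF that] norm_mult norm_u)
    moreover have "((\<lambda>T. of_real (\<rho> T) * u) \<longlongrightarrow> of_real 1 * u) at_top"
      by (intro tendsto_intros \<rho>_lim)
    then have "((\<lambda>T. of_real (\<rho> T) * u) \<longlongrightarrow> u) at_top"
      by simp
    \<comment> \<open>An arbitrary solution is known to agree with the explicit one only for T \<ge>
      0, which suffices for a limit at infinity. The limit u lies on the unit circle, whereas every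
      finite time stays inside the disk.\<close>
    then have "(\<Xi> \<longlongrightarrow> u) at_top"
      by (rule Lim_transform_eventually)
        (use eq in \<open>auto intro: eventually_mono[OF eventually_ge_at_top[of 0]]\<close>)
    moreover have "u \<in> frontier (ball 0 1)"
      by (simp add: norm_u)
    ultimately show ?thesis using eq by blast
  qed
  then have "\<forall>\<Xi>. cauchy_solution s \<Xi>\<^sub>0 \<Xi> \<longrightarrow>
      (\<forall>T\<ge>0. \<Xi> T = of_real (\<rho> T) * exp (\<i> * of_real (\<phi> T))) \<and> (\<forall>T\<ge>0. sgn (\<Xi> T) = sgn \<Xi>\<^sub>0) \<and>
      (\<forall>T\<ge>0. \<Xi> T \<in> ball 0 1) \<and> (\<exists>\<xi> \<in> frontier (ball 0 1). (\<Xi> \<longlongrightarrow> \<xi>) at_top)"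
    by (simp add: assms(6) u_def)
  moreover have "\<Xi>\<^sub>0 \<in> ball 0 1 - {0}"
    using \<rho>\<^sub>0 norm_u by (auto simp: \<Xi>\<^sub>0 norm_mult)
  ultimately show ?thesis
    using \<mu> sol \<rho>_lim unfolding radial by blast
qed

end
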